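(* Let $\delta\ge 0$ be an integer and consider the $\delta$-hook, i.e. the scenario $sd^{\delta}$. Its startperiod is $A_M = 2^{\delta+2}$ and its endperiod is $A_N = 6$. Its phases are as follows. If $\delta$ is even, the startphase is $B_M = (2^{\delta+1}+1)/3$ and the endphase is $B_N = 1$. If $\delta$ is odd, the startphase is $B_M = (5\cdot 2^{\delta+1}+1)/3$ and the endphase is $B_N = 5$.
   Context: Collatz operations on positive integers: "s" (spike) is $m\mapsto (3m+1)/2$, applied when $m$ is odd; "d" (down) is $m\mapsto m/2$, applied when $m$ is even. A scenario is a finite nonempty word in the letters s and d whose first letter is s; exponents denote repetition, so $sd^{\delta}$ is one s followed by $\delta$ letters d. A realization of a scenario is a sequence of positive integers obtained from a positive odd integer $M$ (the startnumber) by performing, from left to right, the operations spelled out by the word, where at each step s is applied to an odd integer and d to an even integer, and where the final integer $N$ (the endnumber) is odd. A scenario uniquely determines integers $A_M, A_N$ (even) and $B_M, B_N$ (odd) such that, for $k=1,2,3,\dots$, the $k$-th realization (all realizations being listed in increasing order of startnumber) has startnumber $M_k=A_M k-B_M$ and endnumber $N_k=A_N k-B_N$. The integers $A_M$, $A_N$, $B_M$, $B_N$ are called the startperiod, endperiod, startphase and endphase, respectively. *)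

theory Defs
  imports Complex_Main
begin

datatype letter = Spike | Down

text \<open>
  The division in \<open>perform\<close> is exact whenever \<open>applicable\<close> holds, and only then is
  \<open>perform\<close> used.
\<close>

fun applicable :: "letter \<Rightarrow> nat \<Rightarrow> bool" where
  "applicable Spike m \<longleftrightarrow> odd m"
| "applicable Down m \<longleftrightarrow> even m"

fun perform :: "letter \<Rightarrow> nat \<Rightarrow> nat" where
  "perform Spike m = (3 * m + 1) div 2"
| "perform Down m = m div 2"

definition scenario :: "letter list \<Rightarrow> bool" where
  "scenario w \<longleftrightarrow> w \<noteq> [] \<and> hd w = Spike"

definition realization :: "letter list \<Rightarrow> nat list \<Rightarrow> bool" where
  "realization w xs \<longleftrightarrow>
     length xs = length w + 1 \<and>
     (\<forall>x\<in>set xs. x > 0) \<and>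
     odd (hd xs) \<and>
     (\<forall>i<length w. applicable (w ! i) (xs ! i) \<and> xs ! (i + 1) = perform (w ! i) (xs ! i)) \<and>
     odd (last xs)"

definition startnumber :: "nat list \<Rightarrow> nat" where
  "startnumber xs = hd xs"

definition endnumber :: "nat list \<Rightarrow> nat" where
  "endnumber xs = last xs"

text \<open>
  \<open>R 1, R 2, R 3, \<dots>\<close> are all realizations of \<open>w\<close>, in increasing order of startnumber.
\<close>

definition lists_realizations :: "letter list \<Rightarrow> (nat \<Rightarrow> nat list) \<Rightarrow> bool" where
  "lists_realizations w R \<longleftrightarrow>
     bij_betw R {1..} {xs. realization w xs} \<and>
     strict_mono_on {1..} (\<lambda>k. startnumber (R k))"

definition periods_phases :: "letter list \<Rightarrow> int \<Rightarrow> int \<Rightarrow> int \<Rightarrow> int \<Rightarrow> bool" where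
  "periods_phases w A\<^sub>M A\<^sub>N B\<^sub>M B\<^sub>N \<longleftrightarrow>
     even A\<^sub>M \<and> even A\<^sub>N \<and> odd B\<^sub>M \<and> odd B\<^sub>N \<and>
     (\<exists>R. lists_realizations w R \<and>
        (\<forall>k\<ge>1. int (startnumber (R k)) = A\<^sub>M * int k - B\<^sub>M \<and>
               int (endnumber (R k)) = A\<^sub>N * int k - B\<^sub>N))"

text \<open>
  The descriptions below are proper for every scenario, by the lemmas
  \<open>periods_phases_unique\<close> and \<open>periods_phases_exist\<close> at the end of this theory.
\<close>

definition startperiod :: "letter list \<Rightarrow> int" where
  "startperiod w = (THE A\<^sub>M. \<exists>A\<^sub>N B\<^sub>M B\<^sub>N. periods_phases w A\<^sub>M A\<^sub>N B\<^sub>M B\<^sub>N)"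

definition endperiod :: "letter list \<Rightarrow> int" where
  "endperiod w = (THE A\<^sub>N. \<exists>A\<^sub>M B\<^sub>M B\<^sub>N. periods_phases w A\<^sub>M A\<^sub>N B\<^sub>M B\<^sub>N)"

definition startphase :: "letter list \<Rightarrow> int" where
  "startphase w = (THE B\<^sub>M. \<exists>A\<^sub>M A\<^sub>N B\<^sub>N. periods_phases w A\<^sub>M A\<^sub>N B\<^sub>M B\<^sub>N)"

definition endphase :: "letter list \<Rightarrow> int" where
  "endphase w = (THE B\<^sub>N. \<exists>A\<^sub>M A\<^sub>N B\<^sub>M. periods_phases w A\<^sub>M A\<^sub>N B\<^sub>M B\<^sub>N)"

definition hook :: "nat \<Rightarrow> letter list" where
  "hook \<delta> = Spike # replicate \<delta> Down"

subsection \<open>Every scenario determines its periods and phases\<close>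

fun trajectory :: "letter list \<Rightarrow> nat \<Rightarrow> nat list" where
  "trajectory [] m = [m]"
| "trajectory (l # w) m = m # trajectory w (perform l m)"

fun runnable :: "letter list \<Rightarrow> nat \<Rightarrow> bool" where
  "runnable [] m \<longleftrightarrow> True"
| "runnable (l # w) m \<longleftrightarrow> applicable l m \<and> runnable w (perform l m)"

definition final :: "letter list \<Rightarrow> nat \<Rightarrow> nat" where
  "final w m = fold perform w m"

lemma trajectory_simps [simp]:
  "length (trajectory w m) = length w + 1"
  "trajectory w m \<noteq> []"
  "hd (trajectory w m) = m"
  "last (trajectory w m) = final w m"
  by (induction w m rule: trajectory.induct) (auto simp: final_def)

lemma runnable_snoc:
  "runnable (w @ [l]) m \<longleftrightarrow> runnable w m \<and> applicable l (final w m)"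
  by (induction w m rule: trajectory.induct) (auto simp: final_def)

lemma final_snoc: "final (w @ [l]) m = perform l (final w m)"
  by (simp add: final_def)

lemma perform_pos: "applicable l m \<Longrightarrow> m > 0 \<Longrightarrow> perform l m > 0"
  by (cases l) (auto elim!: evenE)

lemma trajectory_pos:
  "runnable w m \<Longrightarrow> m > 0 \<Longrightarrow> x \<in> set (trajectory w m) \<Longrightarrow> x > 0"
  by (induction w m rule: trajectory.induct) (auto simp: perform_pos)

lemma trajectory_steps:
  "length xs = length w + 1 \<and>
     (\<forall>i<length w. applicable (w ! i) (xs ! i) \<and> xs ! (i + 1) = perform (w ! i) (xs ! i))
   \<longleftrightarrow> xs = trajectory w (hd xs) \<and> runnable w (hd xs)"
proof (induction w arbitrary: xs)
  case Nil
  then show ?case by (cases xs) auto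
next
  case (Cons l w)
  show ?case
  proof (cases xs)
    case Nil
    then show ?thesis by simp
  next
    case xs: (Cons x ys)
    show ?thesis
    proof (cases ys)
      case Nil
      then show ?thesis using xs trajectory_simps(2)[of w] by (metis One_nat_def Suc_eq_plus1
          add_is_0 length_Cons list.inject list.size(3) nat.inject trajectory.simps(2) zero_neq_one)
    next
      case (Cons y zs)
      have "length xs = length (l # w) + 1 \<and>
            (\<forall>i<length (l # w). applicable ((l # w) ! i) (xs ! i) \<and>
               xs ! (i + 1) = perform ((l # w) ! i) (xs ! i)) \<longleftrightarrow>
            applicable l x \<and> y = perform l x \<and> length ys = length w + 1 \<and>
            (\<forall>i<length w. applicable (w ! i) (ys ! i) \<and> ys ! (i + 1) = perform (w ! i) (ys ! i))"
        using xs Cons by (simp add: All_less_Suc2) blast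
      also have "\<dots> \<longleftrightarrow> applicable l x \<and> y = perform l x \<and> ys = trajectory w y \<and> runnable w y"
        using Cons.IH[of ys] Cons by auto
      also have "\<dots> \<longleftrightarrow> xs = trajectory (l # w) (hd xs) \<and> runnable (l # w) (hd xs)"
        using xs Cons by (auto) (metis list.sel(1) trajectory_simps(3))+
      finally show ?thesis .
    qed
  qed
qed

lemma realization_iff:
  "realization w xs \<longleftrightarrow>
     xs = trajectory w (hd xs) \<and> runnable w (hd xs) \<and> odd (hd xs) \<and> odd (final w (hd xs))"
proof -
  have "realization w xs \<longleftrightarrow>
     xs = trajectory w (hd xs) \<and> runnable w (hd xs) \<and> (\<forall>x\<in>set xs. x > 0) \<and>
     odd (hd xs) \<and> odd (last xs)"
    unfolding realization_def using trajectory_steps[of xs w] by blast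
  also have "\<dots> \<longleftrightarrow> 
     xs = trajectory w (hd xs) \<and> runnable w (hd xs) \<and> odd (hd xs) \<and> odd (final w (hd xs))"
    by (metis odd_pos trajectory_pos trajectory_simps(4))
  finally show ?thesis .
qed

lemma strict_mono_listing_unique:
  fixes f g :: "nat \<Rightarrow> nat"
  assumes f: "strict_mono_on {1..} f" and g: "strict_mono_on {1..} g"
    and im: "f ` {1..} = g ` {1..}" and "k \<ge> 1"
  shows "f k = g k"
proof -
  have key: "\<not> f' k < g' k"
    if IH: "\<And>j. j < k \<Longrightarrow> j \<ge> 1 \<Longrightarrow> f' j = g' j" and k: "k \<ge> 1"
      and f': "strict_mono_on {1..} f'" and g': "strict_mono_on {1..} g'"
      and im': "f' ` {1..} = g' ` {1..}" for f' g' :: "nat \<Rightarrow> nat" and k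
  proof
    assume less: "f' k < g' k"
    have "f' k \<in> g' ` {1..}"
      using im' k by (metis atLeast_iff imageI)
    then obtain j where j: "j \<ge> 1" "f' k = g' j" by auto
    then have "j < k"
      using less strict_mono_onD[OF g', of k j] k by (metis atLeast_iff less_asym linorder_neqE_nat)
    then have "f' k = f' j" and "f' j < f' k"
      using IH j strict_mono_onD[OF f', of j k] k by auto
    then show False by simp
  qed
  show ?thesis
    using \<open>k \<ge> 1\<close>
  proof (induction k rule: less_induct)
    case (less k)
    show ?case
      using key[of k f g] key[of k g f] less f g im by (metis linorder_neqE_nat)
  qed
qed

lemma lists_realizations_unique:
  assumes R: "lists_realizations w R" and R': "lists_realizations w R'" and k: "k \<ge> 1"
  shows "R k = R' k"
proof -
  have im: "R ` {1..} = {xs. realization w xs}" "R' ` {1..} = {xs. realization w xs}"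
    using R R' by (auto simp: lists_realizations_def bij_betw_def)
  then have "startnumber ` R ` {1..} = startnumber ` R' ` {1..}"
    by simp
  then have "(\<lambda>k. startnumber (R k)) ` {1..} = (\<lambda>k. startnumber (R' k)) ` {1..}"
    by (simp only: image_image)
  then have "startnumber (R k) = startnumber (R' k)"
    using strict_mono_listing_unique[of "\<lambda>k. startnumber (R k)" "\<lambda>k. startnumber (R' k)"] R R' k
    unfolding lists_realizations_def by blast
  moreover have "realization w (R k)" "realization w (R' k)"
    using im k by auto
  ultimately show ?thesis
    by (metis realization_iff startnumber_def)
qed

lemma periods_phases_unique:
  assumes "periods_phases w a b c d" and "periods_phases w a' b' c' d'"
  shows "a = a' \<and> b = b' \<and> c = c' \<and> d = d'"
proof -
  obtain R where R: "lists_realizations w R"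
    "\<And>k. k \<ge> 1 \<Longrightarrow> int (startnumber (R k)) = a * int k - c \<and> int (endnumber (R k)) = b * int k - d"
    using assms(1) unfolding periods_phases_def by blast
  obtain R' where R': "lists_realizations w R'"
    "\<And>k. k \<ge> 1 \<Longrightarrow> int (startnumber (R' k)) = a' * int k - c' \<and> int (endnumber (R' k)) = b' * int k - d'"
    using assms(2) unfolding periods_phases_def by blast
  have "a * int k - c = a' * int k - c' \<and> b * int k - d = b' * int k - d'" if "k \<ge> 1" for k
    using R(2)[OF that] R'(2)[OF that] lists_realizations_unique[OF R(1) R'(1) that] by simp
  from this[of 1] this[of 2] show ?thesis by auto
qed

lemma parity_progression:
  fixes c q :: nat
  assumes "odd q"
  obtains j\<^sub>0 where "j\<^sub>0 < 2" "\<And>j. even (c + q * j) = b \<longleftrightarrow> even (j + j\<^sub>0)"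
proof (cases "even c = b")
  case True
  then show ?thesis using assms by (intro that[of 0]) auto
next
  case False
  then show ?thesis using assms by (intro that[of 1]) auto
qed

lemma even_add_iff_progression:
  fixes j j\<^sub>0 :: nat
  assumes "j\<^sub>0 < 2"
  shows "even (j + j\<^sub>0) \<longleftrightarrow> (\<exists>i. j = j\<^sub>0 + 2 * i)"
  using assms by presburger

lemma runnable_progression:
  "\<exists>a c u.
     (\<forall>m. runnable w m \<longleftrightarrow> (\<exists>j. m = a + 2 ^ length w * j)) \<and>
     (\<forall>j. final w (a + 2 ^ length w * j) = c + 3 ^ u * j)"
proof (induction w rule: rev_induct)
  case Nil
  show ?case by (rule exI[where x = 0], rule exI[where x = 0], rule exI[where x = 0]) (simp add: final_def)
next
  case (snoc l w)
  let ?n = "length w"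
  obtain a c u where
    run: "\<And>m. runnable w m \<longleftrightarrow> (\<exists>j. m = a + 2 ^ ?n * j)"
    and fin: "\<And>j. final w (a + 2 ^ ?n * j) = c + 3 ^ u * j"
    using snoc.IH by blast
  have applicable_iff: "applicable l m \<longleftrightarrow> even m = (l = Down)" for m by (cases l) auto
  obtain j0 where j0: "j0 < 2" "\<And>j. applicable l (c + 3 ^ u * j) \<longleftrightarrow> even (j + j0)"
    unfolding applicable_iff
    by (rule parity_progression[where q = "3 ^ u" and c = c and b = "l = Down"]) auto
  let ?a = "a + 2 ^ ?n * j0"
  have prog: "a + 2 ^ ?n * (j0 + 2 * i) = ?a + 2 ^ length (w @ [l]) * i" for i
    by (simp add: algebra_simps)
  have run': "runnable (w @ [l]) m \<longleftrightarrow> (\<exists>i. m = ?a + 2 ^ length (w @ [l]) * i)" for m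
  proof -
    have "runnable (w @ [l]) m \<longleftrightarrow> (\<exists>j. m = a + 2 ^ ?n * j \<and> even (j + j0))"
      unfolding runnable_snoc run using fin j0(2) by metis
    also have "\<dots> \<longleftrightarrow> (\<exists>i. m = a + 2 ^ ?n * (j0 + 2 * i))"
      unfolding even_add_iff_progression[OF j0(1)] by blast
    finally show ?thesis unfolding prog .
  qed
  have app: "applicable l (c + 3 ^ u * j0)" using j0(2)[of j0] by simp
  have fin': "final (w @ [l]) (?a + 2 ^ length (w @ [l]) * i)
      = perform l (c + 3 ^ u * j0) + 3 ^ (if l = Spike then Suc u else u) * i" for i
  proof -
    have "final (w @ [l]) (?a + 2 ^ length (w @ [l]) * i)
        = perform l (c + 3 ^ u * j0 + 2 * (3 ^ u * i))"
      unfolding final_snoc prog[symmetric] fin by (simp add: algebra_simps)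
    also have "\<dots> = perform l (c + 3 ^ u * j0) + 3 ^ (if l = Spike then Suc u else u) * i"
      using app by (cases l) (auto elim!: evenE oddE simp: algebra_simps)
    finally show ?thesis .
  qed
  show ?case using run' fin' by blast
qed

lemma periods_phases_exist:
  assumes "scenario w"
  shows "\<exists>A\<^sub>M A\<^sub>N B\<^sub>M B\<^sub>N. periods_phases w A\<^sub>M A\<^sub>N B\<^sub>M B\<^sub>N"
proof -
  obtain a c u where
    run: "\<And>m. runnable w m \<longleftrightarrow> (\<exists>j. m = a + 2 ^ length w * j)"
    and fin: "\<And>j. final w (a + 2 ^ length w * j) = c + 3 ^ u * j"
    using runnable_progression by metis
  define p :: nat where "p = 2 ^ length w"
  define q :: nat where "q = 3 ^ u"
  have "odd q" "p > 0" by (simp_all add: p_def q_def)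
  obtain j0 where j0: "j0 < 2" "\<And>j. odd (c + q * j) \<longleftrightarrow> even (j + j0)"
    using parity_progression[where q = q and c = c and b = False] \<open>odd q\<close> by auto
  define a' where "a' = a + p * j0"
  define c' where "c' = c + q * j0"
  have odd_start: "odd m" if "runnable w m" for m
    using that assms by (cases w) (auto simp: scenario_def)
  have start: "runnable w m \<and> odd (final w m) \<longleftrightarrow> (\<exists>i. m = a' + 2 * p * i)" for m
  proof -
    have "runnable w m \<and> odd (final w m) \<longleftrightarrow> (\<exists>j. m = a + p * j \<and> even (j + j0))"
      unfolding run p_def using fin j0(2) by (metis q_def)
    also have "\<dots> \<longleftrightarrow> (\<exists>i. m = a + p * (j0 + 2 * i))"
      unfolding even_add_iff_progression[OF j0(1)] by blast
    finally show ?thesis by (simp add: a'_def algebra_simps)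
  qed
  have final: "final w (a' + 2 * p * i) = c' + 2 * q * i" for i
  proof -
    have "a' + 2 * p * i = a + 2 ^ length w * (j0 + 2 * i)"
      by (simp add: a'_def p_def algebra_simps)
    then have "final w (a' + 2 * p * i) = c + 3 ^ u * (j0 + 2 * i)" using fin by simp
    then show ?thesis by (simp add: c'_def q_def algebra_simps)
  qed
  have "odd a'" using start[of a'] odd_start[of a'] by auto
  moreover have "odd c'" using j0(2)[of j0] by (simp add: c'_def)
  moreover define R where "R k = trajectory w (a' + 2 * p * (k - 1))" for k
  have R_start: "startnumber (R k) = a' + 2 * p * (k - 1)" for k
    by (simp add: R_def startnumber_def)
  have R_end: "endnumber (R k) = c' + 2 * q * (k - 1)" for k
    by (simp add: R_def endnumber_def final)
  have mono: "strict_mono_on {1..} (\<lambda>k. startnumber (R k))"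
    using \<open>p > 0\<close> by (auto simp: R_start strict_mono_on_def)
  moreover have "bij_betw R {1..} {xs. realization w xs}"
    unfolding bij_betw_def
  proof
    show "inj_on R {1..}"
      using strict_mono_on_imp_inj_on[OF mono] by (auto simp: inj_on_def)
    show "R ` {1..} = {xs. realization w xs}"
    proof (intro equalityI subsetI)
      fix xs assume "xs \<in> R ` {1..}"
      then obtain i where i: "xs = trajectory w (a' + 2 * p * i)" by (auto simp: R_def)
      moreover have "runnable w (a' + 2 * p * i) \<and> odd (final w (a' + 2 * p * i))"
        unfolding start by blast
      ultimately have "realization w xs" using odd_start[of "a' + 2 * p * i"] by (simp add: realization_iff)
      then show "xs \<in> {xs. realization w xs}" by simp
    next
      fix xs assume "xs \<in> {xs. realization w xs}"
      then have "xs = trajectory w (hd xs)" and "runnable w (hd xs) \<and> odd (final w (hd xs))"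
        using realization_iff by blast+
      then obtain i where "xs = R (Suc i)" unfolding start by (auto simp: R_def)
      then show "xs \<in> R ` {1..}" by auto
    qed
  qed
  moreover have "int (startnumber (R k)) = 2 * int p * int k - (2 * int p - int a') \<and>
      int (endnumber (R k)) = 2 * int q * int k - (2 * int q - int c')" if "k \<ge> 1" for k
  proof -
    obtain i where "k = Suc i" using \<open>k \<ge> 1\<close> by (cases k) auto
    then show ?thesis by (simp add: R_start R_end algebra_simps)
  qed
  ultimately have "periods_phases w (2 * int p) (2 * int q) (2 * int p - int a') (2 * int q - int c')"
    unfolding periods_phases_def lists_realizations_def by auto
  then show ?thesis by blast
qed

end

theory Submission
  imports Defs
begin

text \<open>
  A positive integer \<open>m\<close> starts a realization of \<open>s d\<^sup>\<delta>\<close> with endnumber \<open>n\<close> iff \<open>n\<close> is odd and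
  \<open>3 * m + 1 = 2 ^ (\<delta> + 1) * n\<close>. Let \<open>b'\<close> be odd with \<open>3 * b = 2 ^ (\<delta> + 1) * b' + 1\<close>; then
  \<open>3 * (m + b) = 2 ^ (\<delta> + 1) * (n + b')\<close>, so \<open>6\<close> divides \<open>n + b'\<close>, and writing \<open>n + b' = 6 * k\<close>
  gives \<open>m + b = 2 ^ (\<delta> + 2) * k\<close>. It remains to choose \<open>b' \<in> {1, 5}\<close> according to the
  residue of \<open>2 ^ (\<delta> + 1)\<close> modulo \<open>3\<close>.
\<close>

text \<open>By uniqueness, a single witness settles all four definite descriptions at once.\<close>

lemma periods_phases_values:
  assumes "periods_phases w a a' b b'"
  shows "startperiod w = a" "endperiod w = a'" "startphase w = b" "endphase w = b'"
  unfolding startperiod_def endperiod_def startphase_def endphase_def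
  by (rule the_equality; use assms periods_phases_unique[OF _ assms] in blast)+

text \<open>A realization is the trajectory of its startnumber, so listing realizations amounts to
  listing startnumbers. These increase with \<open>k\<close> because \<open>0 < a\<close>.\<close>

lemma periods_phasesI:
  assumes "even a" "even a'" "odd b" "odd b'" "0 < a" "b < a"
    and start: "\<And>m. runnable w m \<and> odd m \<and> odd (final w m) \<longleftrightarrow> (\<exists>k\<ge>1. int m = a * int k - b)"
    and final: "\<And>m k. k \<ge> 1 \<Longrightarrow> int m = a * int k - b \<Longrightarrow> int (final w m) = a' * int k - b'"
  shows "periods_phases w a a' b b'"
proof -
  define M where "M k = nat (a * int k - b)" for k
  define R where "R k = trajectory w (M k)" for k
  \<comment> \<open>For \<open>k \<ge> 1\<close>, \<open>a * k \<ge> a > b\<close>, so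
    \<open>nat\<close> truncates nothing.\<close>
  have M: "int (M k) = a * int k - b" if "k \<ge> 1" for k
  proof -
    have "a * 1 \<le> a * int k"
      using that \<open>0 < a\<close> by (intro mult_left_mono) auto
    then show ?thesis using \<open>b < a\<close> by (simp add: M_def)
  qed
  have R_start: "startnumber (R k) = M k" for k
    by (simp add: R_def startnumber_def)
  have mono: "strict_mono_on {1..} (\<lambda>k. startnumber (R k))"
  proof (rule strict_mono_onI)
    fix j k :: nat
    assume "j \<in> {1..}" "k \<in> {1..}" "j < k"
    then have "int (M j) < int (M k)"
      using \<open>0 < a\<close> by (simp add: M)
    then show "startnumber (R j) < startnumber (R k)"
      by (simp add: R_start)
  qed
  have "R ` {1..} = {xs. realization w xs}"
  proof (intro equalityI subsetI)
    fix xs assume "xs \<in> R ` {1..}"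
    then obtain k where "k \<ge> 1" and xs: "xs = trajectory w (M k)" by (auto simp: R_def)
    then have "runnable w (M k) \<and> odd (M k) \<and> odd (final w (M k))"
      unfolding start using M by blast
    then show "xs \<in> {xs. realization w xs}" by (simp add: xs realization_iff)
  next
    fix xs assume "xs \<in> {xs. realization w xs}"
    then have xs: "xs = trajectory w (hd xs)"
      and "runnable w (hd xs) \<and> odd (hd xs) \<and> odd (final w (hd xs))"
      using realization_iff by blast+
    then obtain k where k: "k \<ge> 1" "int (hd xs) = a * int k - b"
      unfolding start by blast
    then have "hd xs = M k" using M by (metis of_nat_eq_iff)
    then have "xs = R k" using xs by (simp add: R_def)
    then show "xs \<in> R ` {1..}" using k by simp
  qed
  moreover have "inj_on R {1..}"
    using strict_mono_on_imp_inj_on[OF mono] by (auto simp: inj_on_def)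
  ultimately have "lists_realizations w R"
    using mono by (simp add: lists_realizations_def bij_betw_def)
  moreover have "int (startnumber (R k)) = a * int k - b \<and> int (endnumber (R k)) = a' * int k - b'"
    if "k \<ge> 1" for k
    using M[OF that] final[OF that M[OF that]] by (simp add: R_def startnumber_def endnumber_def)
  ultimately show ?thesis
    using assms(1-4) unfolding periods_phases_def by blast
qed

text \<open>Divisibility by \<open>2 ^ \<delta>\<close> encodes all the evenness tests together. The
  induction peels off the first letter, which replaces \<open>m\<close> by \<open>m div 2\<close>;
  hence \<open>m\<close> is arbitrary.\<close>

lemma runnable_final_replicate_Down:
  "runnable (replicate \<delta> Down) m \<and> final (replicate \<delta> Down) m = n \<longleftrightarrow> m = 2 ^ \<delta> * n"
proof (induction \<delta> arbitrary: m)
  case 0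
  then show ?case by (simp add: final_def)
next
  case (Suc \<delta>)
  have "runnable (replicate (Suc \<delta>) Down) m \<and> final (replicate (Suc \<delta>) Down) m = n
      \<longleftrightarrow> even m \<and> m div 2 = 2 ^ \<delta> * n"
    using Suc.IH[of "m div 2"] by (auto simp: final_def)
  also have "\<dots> \<longleftrightarrow> m = 2 ^ Suc \<delta> * n"
    by auto
  finally show ?case .
qed

text \<open>The right side needs no parity condition: its factor 2 makes \<open>3 * m + 1\<close>
  even, which forces \<open>m\<close> odd and the halving exact.\<close>

lemma runnable_final_hook:
  "runnable (hook \<delta>) m \<and> final (hook \<delta>) m = n \<longleftrightarrow> 3 * m + 1 = 2 ^ (\<delta> + 1) * n"
proof -
  have "runnable (hook \<delta>) m \<and> final (hook \<delta>) m = n \<longleftrightarrow> odd m \<and> (3 * m + 1) div 2 = 2 ^ \<delta> * n"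
    using runnable_final_replicate_Down[of \<delta> "(3 * m + 1) div 2" n]
    by (auto simp: hook_def final_def)
  also have "\<dots> \<longleftrightarrow> 3 * m + 1 = 2 * (2 ^ \<delta> * n)"
    by presburger
  finally show ?thesis by (simp add: mult.assoc)
qed

lemma periods_phases_hook:
  fixes b b' :: int
  assumes b: "3 * b = 2 ^ (\<delta> + 1) * b' + 1" and b': "odd b'" "0 < b'" "b' < 6"
  shows "periods_phases (hook \<delta>) (2 ^ (\<delta> + 2)) 6 b b'"
proof (rule periods_phasesI)
  have "odd (3 * b)" unfolding b by simp
  then show "odd b" by simp
  \<comment> \<open>With \<open>P = 2 ^ (\<delta> + 1)\<close>, this yields
    \<open>3 * b \<le> 5 * P + 1 < 6 * P\<close>, that is \<open>b < 2 * P\<close>.\<close>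
  have "2 ^ (\<delta> + 1) * b' \<le> 2 ^ (\<delta> + 1) * (5 :: int)"
    using b' by (intro mult_left_mono) auto
  moreover have "(1 :: int) < 2 ^ (\<delta> + 1)"
    by (rule one_less_power) auto
  moreover have "(2 :: int) ^ (\<delta> + 2) = 2 * 2 ^ (\<delta> + 1)"
    by simp
  ultimately show "b < 2 ^ (\<delta> + 2)"
    using b by linarith
next
  have hook: "runnable (hook \<delta>) m \<and> final (hook \<delta>) m = n
      \<longleftrightarrow> 3 * (int m + b) = 2 ^ (\<delta> + 1) * (int n + b')" for m n
  proof -
    have "3 * m + 1 = 2 ^ (\<delta> + 1) * n \<longleftrightarrow> int (3 * m + 1) = int (2 ^ (\<delta> + 1) * n)"
      by (simp only: of_nat_eq_iff)
    also have "\<dots> \<longleftrightarrow> 3 * (int m + b) = 2 ^ (\<delta> + 1) * (int n + b')"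
      using b by (simp add: algebra_simps)
    finally show ?thesis unfolding runnable_final_hook .
  qed
  \<comment> \<open>Both sides of \<open>hook\<close> become
    \<open>3 * 2 ^ (\<delta> + 2) * k\<close>; \<open>nat\<close> is exact since
    \<open>6 * k \<ge> 6 > b'\<close>.\<close>
  have backward: "runnable (hook \<delta>) m \<and> final (hook \<delta>) m = nat (6 * int k - b')"
    if "k \<ge> 1" "int m = 2 ^ (\<delta> + 2) * int k - b" for m k
    unfolding hook using that b' by simp
  show "int (final (hook \<delta>) m) = 6 * int k - b'"
    if "k \<ge> 1" "int m = 2 ^ (\<delta> + 2) * int k - b" for m k
    using backward[OF that] that b' by simp
  show "runnable (hook \<delta>) m \<and> odd m \<and> odd (final (hook \<delta>) m)
      \<longleftrightarrow> (\<exists>k\<ge>1. int m = 2 ^ (\<delta> + 2) * int k - b)" for m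
  proof
    assume m: "runnable (hook \<delta>) m \<and> odd m \<and> odd (final (hook \<delta>) m)"
    define n where "n = final (hook \<delta>) m"
    have eq: "3 * (int m + b) = 2 ^ (\<delta> + 1) * (int n + b')"
      using m hook n_def by blast
    then have "3 dvd 2 ^ (\<delta> + 1) * (int n + b')"
      by (metis dvd_triv_left)
    moreover have "coprime 3 (2 ^ (\<delta> + 1) :: int)"
      by (simp add: coprime_power_right_iff coprime_right_2_iff_odd)
    ultimately have "3 dvd int n + b'"
      using coprime_dvd_mult_right_iff by blast
    moreover have "even (int n + b')"
      using m b' by (simp add: n_def)
    ultimately have "6 dvd int n + b'"
      by presburger
    then obtain k where k: "int n + b' = 6 * k" by (elim dvdE)
    \<comment> \<open>Here \<open>k\<close> is an integer, and
      \<open>6 * k = n + b' > 0\<close>.\<close>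
    then have "k \<ge> 1" using b' by linarith
    moreover have "int m = 2 ^ (\<delta> + 2) * k - b"
      using eq unfolding k by simp
    ultimately show "\<exists>k\<ge>1. int m = 2 ^ (\<delta> + 2) * int k - b"
      by (intro exI[of _ "nat k"]) auto
  next
    assume "\<exists>k\<ge>1. int m = 2 ^ (\<delta> + 2) * int k - b"
    then obtain k where k: "k \<ge> 1" "int m = 2 ^ (\<delta> + 2) * int k - b" by blast
    then have "odd (6 * int k - b')" "0 \<le> 6 * int k - b'" using b' by auto
    then have "odd (nat (6 * int k - b'))" by (simp add: even_nat_iff)
    moreover have "odd m" using backward[OF k] by (simp add: hook_def)
    ultimately show "runnable (hook \<delta>) m \<and> odd m \<and> odd (final (hook \<delta>) m)"
      using backward[OF k] by simp
  qed
qed (use b' in auto)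

text \<open>Modulo 3, \<open>2\<close> is \<open>-1\<close>, so the power is \<open>-1\<close> for
  even \<open>\<delta>\<close> and \<open>1\<close> for odd \<open>\<delta>\<close>. As
  \<open>5\<close> is also \<open>-1\<close>, the product is \<open>-1\<close> in both
  cases.\<close>

lemma three_dvd_power_of_two:
  "(3 :: int) dvd 2 ^ (\<delta> + 1) * (if even \<delta> then 1 else 5) + 1"
proof (induction \<delta>)
  case (Suc \<delta>)
  then show ?case by (cases "even \<delta>"; simp; presburger)
qed simp

theorem proposition3p1:
  fixes \<delta> :: nat
  shows "startperiod (hook \<delta>) = 2 ^ (\<delta> + 2) \<and>
         endperiod (hook \<delta>) = 6 \<and>
         (even \<delta> \<longrightarrow>
            real_of_int (startphase (hook \<delta>)) = (2 ^ (\<delta> + 1) + 1) / 3 \<and>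
            endphase (hook \<delta>) = 1) \<and>
         (odd \<delta> \<longrightarrow>
            real_of_int (startphase (hook \<delta>)) = (5 * 2 ^ (\<delta> + 1) + 1) / 3 \<and>
            endphase (hook \<delta>) = 5)"
proof -
  define b' :: int where "b' = (if even \<delta> then 1 else 5)"
  obtain b where b: "2 ^ (\<delta> + 1) * b' + 1 = 3 * b"
    using three_dvd_power_of_two[of \<delta>] unfolding b'_def by (elim dvdE)
  then have "periods_phases (hook \<delta>) (2 ^ (\<delta> + 2)) 6 b b'"
    by (intro periods_phases_hook) (auto simp: b'_def)
  note vals = periods_phases_values[OF this]
  \<comment> \<open>The startphase is stated with real division, so the equation for
    \<open>b\<close> is carried over to the reals.\<close>
  have "real_of_int (3 * b) = real_of_int (2 ^ (\<delta> + 1) * b' + 1)"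
    unfolding b ..
  then show ?thesis
    unfolding vals by (auto simp: b'_def field_simps)
qed

end
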